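(* Let $V$ be a finite set and let $A$ be a real symmetric matrix indexed by $V$. If $A$ has no self-contained pair of weighted chordless walks (i.e., no two weighted chordless walks $W_1,W_2$ in $A$ with $V(W_1)\cup V(W_2)=I(W_1)\cup I(W_2)$), then $A$ has a simplicial vertex.
   Context: An element $v\in V$ is simplicial in $A$ if $A_{yz}\ge\min\{A_{vy},A_{vz}\}$ for all distinct $y,z\in V\setminus\{v\}$. A walk is an ordered sequence $W=(v_0,\dots,v_p)$ ($p\ge1$) of elements of $V$; $V(W)=\{v_0,\dots,v_p\}$, $I(W)=\{v_1,\dots,v_{p-1}\}$. $W$ is weighted chordless in $A$ if $A_{v_{i-1}v_{i+1}}<\min\{A_{v_{i-1}v_i},A_{v_{i+1}v_i}\}$ for all $1\le i\le p-1$. *)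

theory Defs
  imports Complex_Main
begin

(* A matrix indexed by V is a function A :: 'a => 'a => real, considered on V x V. *)

definition simplicial :: "'a set \<Rightarrow> ('a \<Rightarrow> 'a \<Rightarrow> real) \<Rightarrow> 'a \<Rightarrow> bool" where
  "simplicial V A v \<longleftrightarrow> v \<in> V \<and>
     (\<forall>y\<in>V - {v}. \<forall>z\<in>V - {v}. y \<noteq> z \<longrightarrow> A y z \<ge> min (A v y) (A v z))"

(* A walk (v_0,...,v_p), p >= 1, is a list of length p+1 >= 2 of elements of V. *)
definition walk :: "'a set \<Rightarrow> 'a list \<Rightarrow> bool" where
  "walk V W \<longleftrightarrow> length W \<ge> 2 \<and> set W \<subseteq> V"

definition walk_verts :: "'a list \<Rightarrow> 'a set" where
  "walk_verts W = set W"

definition walk_inner :: "'a list \<Rightarrow> 'a set" where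
  "walk_inner W = {W ! i | i. 1 \<le> i \<and> i < length W - 1}"

definition weighted_chordless :: "('a \<Rightarrow> 'a \<Rightarrow> real) \<Rightarrow> 'a list \<Rightarrow> bool" where
  "weighted_chordless A W \<longleftrightarrow>
     (\<forall>i. 1 \<le> i \<and> i < length W - 1 \<longrightarrow>
        A (W ! (i - 1)) (W ! (i + 1)) < min (A (W ! (i - 1)) (W ! i)) (A (W ! (i + 1)) (W ! i)))"

definition self_contained_pair :: "'a set \<Rightarrow> ('a \<Rightarrow> 'a \<Rightarrow> real) \<Rightarrow> 'a list \<Rightarrow> 'a list \<Rightarrow> bool" where
  "self_contained_pair V A W1 W2 \<longleftrightarrow>
     walk V W1 \<and> walk V W2 \<and> weighted_chordless A W1 \<and> weighted_chordless A W2 \<and>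
     walk_verts W1 \<union> walk_verts W2 = walk_inner W1 \<union> walk_inner W2"

end

theory Submission
  imports Defs
begin

text \<open>
  We show more: if no vertex of a nonempty set \<open>C \<subseteq> U\<close> is simplicial in \<open>A[U]\<close> and \<open>A[U]\<close> has no
  self-contained pair, then some weighted chordless walk has its two ends outside \<open>C\<close> and a nonempty
  interior inside \<open>C\<close>; the theorem is the case \<open>C = U = V\<close>. The proof is by induction on \<open>U\<close>. Let
  \<open>b\<close> be the least entry of \<open>A[U]\<close> and \<open>H\<close> the graph of the entries above \<open>b\<close>. Walks that are
  chordless in \<open>H\<close> are weighted chordless. If all of \<open>C\<close> is universal in \<open>H\<close>, a single triple
  does. Otherwise \<open>H\<close> has a separator \<open>R\<close> with two full components \<open>D1\<close>, \<open>D2\<close>, and the induction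
  hypothesis for \<open>D1 \<union> R\<close> and \<open>D2 \<union> R\<close> gives walks through \<open>D1\<close> and \<open>D2\<close>; an end in \<open>R\<close> of either
  can be prolonged along a shortest path of \<open>H\<close> through the other component. If that component leaves
  \<open>C\<close>, one prolonged walk is as required; if both components lie in \<open>C\<close>, the two walks are
  prolonged into each other's interior and form a self-contained pair.
\<close>

section \<open>Weighted chordless lists\<close>

lemma walk_inner_eq: "walk_inner (s # ws @ [t]) = set ws"
  unfolding walk_inner_def
proof (intro set_eqI iffI)
  fix x assume "x \<in> {(s # ws @ [t]) ! i |i. 1 \<le> i \<and> i < length (s # ws @ [t]) - 1}"
  then obtain i where "1 \<le> i" "i < length ws + 1" "x = (s # ws @ [t]) ! i" by auto
  then show "x \<in> set ws" by (cases i) (auto simp: nth_append)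
next
  fix x assume "x \<in> set ws"
  then obtain i where i: "i < length ws" "x = ws ! i" by (auto simp: in_set_conv_nth)
  then have "x = (s # ws @ [t]) ! Suc i" by (simp add: nth_append)
  with i show "x \<in> {(s # ws @ [t]) ! i |i. 1 \<le> i \<and> i < length (s # ws @ [t]) - 1}"
    by (intro CollectI exI[of _ "Suc i"]) auto
qed

text \<open>Trades indices for list decompositions, so that walks can be cut, joined and reversed
  without index arithmetic.\<close>

lemma weighted_chordless_iff:
  "weighted_chordless A W \<longleftrightarrow>
     (\<forall>us x y z vs. W = us @ x # y # z # vs \<longrightarrow> A x z < min (A x y) (A z y))"
proof
  assume wc: "weighted_chordless A W"
  show "\<forall>us x y z vs. W = us @ x # y # z # vs \<longrightarrow> A x z < min (A x y) (A z y)"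
  proof (intro allI impI)
    fix us x y z vs assume W: "W = us @ x # y # z # vs"
    show "A x z < min (A x y) (A z y)"
      using wc[unfolded weighted_chordless_def, rule_format, of "Suc (length us)"]
      by (simp add: W nth_append)
  qed
next
  assume dec: "\<forall>us x y z vs. W = us @ x # y # z # vs \<longrightarrow> A x z < min (A x y) (A z y)"
  show "weighted_chordless A W"
    unfolding weighted_chordless_def
  proof (intro allI impI)
    fix i assume i: "1 \<le> i \<and> i < length W - 1"
    then obtain j where j: "i = Suc j" "Suc (Suc j) < length W" by (cases i) auto
    then have "W = take j W @ W ! j # W ! Suc j # W ! Suc (Suc j) # drop (Suc (Suc (Suc j))) W"
      by (simp add: Cons_nth_drop_Suc)
    then have "W = take (i - 1) W @ W ! (i - 1) # W ! i # W ! (i + 1) # drop (i + 2) W"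
      by (simp add: j)
    with dec show "A (W ! (i - 1)) (W ! (i + 1)) <
        min (A (W ! (i - 1)) (W ! i)) (A (W ! (i + 1)) (W ! i))"
      by blast
  qed
qed

lemma weighted_chordless_Cons3:
  "weighted_chordless A (x # y # z # W) \<longleftrightarrow>
     A x z < min (A x y) (A z y) \<and> weighted_chordless A (y # z # W)"
  unfolding weighted_chordless_iff
proof safe
  fix us x' y' z' vs
  assume xyz: "A x z < min (A x y) (A z y)" and eq: "x # y # z # W = us @ x' # y' # z' # vs"
    and tail: "\<forall>us x' y' z' vs. y # z # W = us @ x' # y' # z' # vs \<longrightarrow>
      A x' z' < min (A x' y') (A z' y')"
  show "A x' z' < min (A x' y') (A z' y')"
  proof (cases us)
    case Nil
    with xyz eq show ?thesis by simp
  next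
    case (Cons a us')
    with eq have "y # z # W = us' @ x' # y' # z' # vs" by simp
    then show ?thesis by (rule tail[rule_format])
  qed
next
  assume *: "\<forall>us x' y' z' vs. x # y # z # W = us @ x' # y' # z' # vs \<longrightarrow>
      A x' z' < min (A x' y') (A z' y')"
  show "A x z < min (A x y) (A z y)" using *[rule_format, of "[]"] by simp
  fix us x' y' z' vs assume "y # z # W = us @ x' # y' # z' # vs"
  then show "A x' z' < min (A x' y') (A z' y')" using *[rule_format, of "x # us"] by simp
qed

lemma weighted_chordless_rev:
  assumes "\<forall>x\<in>V. \<forall>y\<in>V. A x y = A y x" "set W \<subseteq> V" "weighted_chordless A W"
  shows "weighted_chordless A (rev W)"
  unfolding weighted_chordless_iff
proof (intro allI impI)
  fix us x y z vs assume "rev W = us @ x # y # z # vs"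
  then have W: "W = rev vs @ z # y # x # rev us"
    by (metis (no_types, lifting) append.assoc append_Cons append_Nil rev.simps(2) rev_append rev_rev_ident)
  then have "A z x < min (A z y) (A x y)"
    using assms(3) unfolding weighted_chordless_iff by blast
  then show "A x z < min (A x y) (A z y)" using assms(1,2) W by auto
qed

text \<open>Every consecutive triple of the joined walk lies in one of the two parts, except
  \<open>x\<close>, \<open>y\<close>, \<open>z\<close>, which the third assumption covers.\<close>

lemma weighted_chordless_append:
  assumes "weighted_chordless A (xs @ [x, y])" "weighted_chordless A (y # z # zs)"
    and "A x z < min (A x y) (A z y)"
  shows "weighted_chordless A (xs @ x # y # z # zs)"
  using assms(1)
proof (induction xs)
  case Nil
  then show ?case using assms(2,3) by (simp add: weighted_chordless_Cons3)
next
  case (Cons a xs)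
  show ?case
  proof (cases xs)
    case Nil
    then show ?thesis using Cons by (simp add: weighted_chordless_Cons3)
  next
    case (Cons c ys)
    then show ?thesis using Cons.IH Cons.prems
      by (cases ys) (simp_all add: weighted_chordless_Cons3)
  qed
qed

section \<open>Shortest paths in a level graph\<close>

text \<open>Take a path of least length: an earlier vertex in \<open>T\<close> would allow
  truncation, and a chord above \<open>b\<close> a shortcut. So \<open>A x z \<le> b\<close> for
  each consecutive triple, while both its edges exceed \<open>b\<close>.\<close>

lemma shortest_level_path:
  fixes A :: "'a \<Rightarrow> 'a \<Rightarrow> real"
  assumes sym: "\<forall>x\<in>U. \<forall>y\<in>U. A x y = A y x" and "D \<subseteq> U"
    and ex: "p0 \<noteq> []" "set p0 \<subseteq> D" "last p0 \<in> T" "successively (\<lambda>x y. b < A x y) (r # p0)"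
  obtains p t where "t \<in> T" "t \<in> D" "set p \<subseteq> D - T" "b < A r (hd (p @ [t]))"
    "weighted_chordless A (r # p @ [t])"
proof -
  define P where "P = (\<lambda>p. p \<noteq> [] \<and> set p \<subseteq> D \<and> last p \<in> T \<and> successively (\<lambda>x y. b < A x y) (r # p))"
  have "P p0" using ex by (simp add: P_def)
  then obtain q where q: "P q" and min: "\<And>q'. P q' \<Longrightarrow> length q \<le> length q'"
    using ex_has_least_nat[of P p0 length] by blast
  from q have "q \<noteq> []" by (simp add: P_def)
  then obtain p t where pt: "q = p @ [t]" by (metis append_butlast_last_id)
  have t: "t \<in> T" "t \<in> D" and pD: "set p \<subseteq> D" and succ: "successively (\<lambda>x y. b < A x y) (r # p @ [t])"
    using q by (auto simp: P_def pt)
  have "u \<notin> T" if "u \<in> set p" for u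
  proof
    assume "u \<in> T"
    obtain us vs where p: "p = us @ u # vs" using \<open>u \<in> set p\<close> by (meson split_list)
    have "successively (\<lambda>x y. b < A x y) ((r # us) @ u # vs @ [t])" using succ by (simp add: p)
    then have "successively (\<lambda>x y. b < A x y) ((r # us) @ [u])"
      unfolding successively_append_iff by auto
    then have "P (us @ [u])" using q \<open>u \<in> T\<close> by (auto simp: P_def pt p)
    then show False using min by (fastforce simp: pt p)
  qed
  moreover have "weighted_chordless A (r # p @ [t])"
    unfolding weighted_chordless_iff
  proof (intro allI impI)
    fix us x y z vs assume eq: "r # p @ [t] = us @ x # y # z # vs"
    have xyz: "b < A x y" "b < A y z"
      using succ unfolding eq by (auto simp: successively_append_iff)
    have "A x z \<le> b"
    proof (rule ccontr)
      assume "\<not> A x z \<le> b"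
      then have xz: "b < A x z" by simp
      show False
      proof (cases us)
        case Nil
        with eq have "q = y # z # vs" "r = x" by (auto simp: pt)
        with q xz have "P (z # vs)" by (auto simp: P_def successively_Cons)
        with min \<open>q = y # z # vs\<close> show False by fastforce
      next
        case (Cons r' us')
        with eq have q': "q = us' @ x # y # z # vs" "r = r'" by (auto simp: pt)
        have "successively (\<lambda>x y. b < A x y) (us @ x # y # z # vs)" using succ by (simp only: eq)
        then have "successively (\<lambda>x y. b < A x y) (us @ x # z # vs)"
          using xz by (simp add: successively_append_iff successively_Cons)
        moreover have "set (us' @ x # y # z # vs) \<subseteq> D" "last (us' @ x # y # z # vs) \<in> T"
          using q unfolding P_def q'(1) by blast+
        ultimately have "P (us' @ x # z # vs)" by (simp add: P_def Cons q'(2))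
        with min q' show False by fastforce
      qed
    qed
    \<comment> \<open>Only the start \<open>r\<close> may lie outside \<open>U\<close>, and it can
      occur here only as \<open>x\<close>; symmetry is applied to the pair \<open>y\<close>,
      \<open>z\<close> alone.\<close>
    moreover have "{y, z} \<subseteq> set (tl (us @ x # y # z # vs))" by (cases us) auto
    then have "y \<in> U" "z \<in> U" using pD t(2) \<open>D \<subseteq> U\<close> unfolding eq[symmetric] by auto
    ultimately show "A x z < min (A x y) (A z y)" using xyz sym by auto
  qed
  moreover have "b < A r (hd (p @ [t]))" using succ by (cases p) auto
  ultimately show ?thesis using that[of t p] t pD by blast
qed

section \<open>Separators of a level graph\<close>

text \<open>The graph is that of the entries above \<open>b\<close>. The last clause stands in for
  connectedness and fullness, in the form in which walks get prolonged: from any vertex of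
  \<open>R\<close> through \<open>D\<close> to a chosen target.\<close>

definition full_component ::
    "('a \<Rightarrow> 'a \<Rightarrow> real) \<Rightarrow> real \<Rightarrow> 'a set \<Rightarrow> 'a set \<Rightarrow> 'a set \<Rightarrow> bool" where
  "full_component A b U R D \<longleftrightarrow> D \<subseteq> U \<and> D \<inter> R = {} \<and>
     (\<forall>x\<in>D. \<forall>y\<in>U. b < A x y \<longrightarrow> y \<in> D \<union> R) \<and>
     (\<forall>r\<in>R. \<forall>d\<in>D. \<exists>p. p \<noteq> [] \<and> set p \<subseteq> D \<and> last p = d \<and> successively (\<lambda>x y. b < A x y) (r # p))"

text \<open>Supplies the path clause of \<open>full_component\<close>: by symmetry \<open>u\<close>
  leads back to \<open>x\<close> and from there to \<open>d\<close> inside the component of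
  \<open>x\<close>.\<close>

lemma level_component_path:
  fixes A :: "'a \<Rightarrow> 'a \<Rightarrow> real"
  assumes sym: "\<forall>x\<in>X. \<forall>y\<in>X. A x y = A y x"
    and E: "E = {(u, v). u \<in> X \<and> v \<in> X \<and> b < A u v}"
    and u: "(x, u) \<in> E\<^sup>*" and d: "(x, d) \<in> E\<^sup>*" and r: "b < A r u"
  shows "\<exists>p. p \<noteq> [] \<and> set p \<subseteq> {v. (x, v) \<in> E\<^sup>*} \<and> last p = d \<and>
    successively (\<lambda>x y. b < A x y) (r # p)"
proof -
  have "sym E" using sym by (auto simp: E sym_def)
  with u have "(u, x) \<in> E\<^sup>*" by (meson sym_rtrancl symD)
  with d have "(u, d) \<in> E\<^sup>*" by auto
  then show ?thesis
  proof (induction rule: rtrancl_induct)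
    case base
    show ?case using u r by (intro exI[of _ "[u]"]) auto
  next
    case (step v w)
    then obtain p where p: "p \<noteq> []" "set p \<subseteq> {v. (x, v) \<in> E\<^sup>*}" "last p = v"
      "successively (\<lambda>x y. b < A x y) (r # p)" by blast
    have "b < A v w" using step.hyps(2) by (simp add: E)
    moreover have "(x, w) \<in> E\<^sup>*" using u step.hyps by auto
    ultimately show ?case using p
      by (intro exI[of _ "p @ [w]"]) (auto simp: successively_append_iff successively_Cons)
  qed
qed

text \<open>\<open>D2\<close> is the component of \<open>y\<close> among the non-neighbours of
  \<open>x\<close>, \<open>R\<close> its neighbourhood, and \<open>D1\<close> the component of
  \<open>x\<close> in \<open>U - R\<close>. A vertex of \<open>R\<close> not adjacent to
  \<open>x\<close> would belong to \<open>D2\<close>, so \<open>R\<close> is adjacent to both sides.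
  The loop at \<open>x\<close> keeps \<open>x\<close> out of \<open>X2\<close>.\<close>

lemma level_separator:
  fixes A :: "'a \<Rightarrow> 'a \<Rightarrow> real"
  assumes sym: "\<forall>x\<in>U. \<forall>y\<in>U. A x y = A y x"
    and x: "x \<in> U" "b < A x x" and y: "y \<in> U" "A x y \<le> b"
  obtains R D1 D2 where "R \<subseteq> U" "full_component A b U R D1" "full_component A b U R D2"
    "D1 \<inter> D2 = {}" "x \<in> D1" "y \<in> D2"
proof -
  define X2 where "X2 = {v \<in> U. \<not> b < A x v}"
  define E2 where "E2 = {(u, v). u \<in> X2 \<and> v \<in> X2 \<and> b < A u v}"
  define D2 where "D2 = {v. (y, v) \<in> E2\<^sup>*}"
  define R where "R = {r \<in> U - D2. \<exists>d\<in>D2. b < A d r}"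
  define X1 where "X1 = U - R"
  define E1 where "E1 = {(u, v). u \<in> X1 \<and> v \<in> X1 \<and> b < A u v}"
  define D1 where "D1 = {v. (x, v) \<in> E1\<^sup>*}"
  have y2: "y \<in> X2" using y by (simp add: X2_def)
  have D2: "v \<in> X2" if "v \<in> D2" for v
  proof -
    have "(y, v) \<in> E2\<^sup>*" using that by (simp add: D2_def)
    then show ?thesis using y2 by (induction rule: rtrancl_induct) (auto simp: E2_def)
  qed
  have R: "b < A x r" if "r \<in> R" for r
  proof (rule ccontr)
    assume "\<not> b < A x r"
    with that have "r \<in> X2" by (simp add: X2_def R_def)
    moreover obtain d where d: "d \<in> D2" "b < A d r" using \<open>r \<in> R\<close> unfolding R_def by blast
    ultimately have "(d, r) \<in> E2" using D2 by (simp add: E2_def)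
    with d have "r \<in> D2" by (auto simp: D2_def)
    with that show False by (simp add: R_def)
  qed
  have x2: "x \<notin> D2" using D2 x by (auto simp: X2_def)
  have "x \<notin> R"
  proof
    assume "x \<in> R"
    then obtain d where d: "d \<in> D2" "b < A d x" unfolding R_def by blast
    with D2 have "d \<in> U" "\<not> b < A x d" by (auto simp: X2_def)
    with d x sym show False by auto
  qed
  then have x1: "x \<in> X1" using x by (simp add: X1_def)
  have D1: "v \<in> X1 \<and> v \<notin> D2" if "v \<in> D1" for v
  proof -
    have "(x, v) \<in> E1\<^sup>*" using that by (simp add: D1_def)
    then show ?thesis
    proof (induction rule: rtrancl_induct)
      case base
      show ?case using x1 x2 by simp
    next
      case (step u v)
      then have uv: "u \<in> X1" "v \<in> X1" "b < A u v" "u \<notin> D2" by (auto simp: E1_def)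
      then have "b < A v u" using sym by (auto simp: X1_def)
      with uv show ?case by (auto simp: X1_def R_def)
    qed
  qed
  have "full_component A b U R D2"
    unfolding full_component_def
  proof (intro conjI ballI impI)
    show "D2 \<subseteq> U" "D2 \<inter> R = {}" using D2 by (auto simp: X2_def R_def)
    show "v \<in> D2 \<union> R" if "u \<in> D2" "v \<in> U" "b < A u v" for u v
      using that by (auto simp: R_def)
    fix r d assume "r \<in> R" "d \<in> D2"
    then obtain u where u: "u \<in> D2" "b < A u r" unfolding R_def by blast
    have "b < A r u" using u \<open>r \<in> R\<close> D2[OF u(1)] sym by (auto simp: R_def X2_def)
    then show "\<exists>p. p \<noteq> [] \<and> set p \<subseteq> D2 \<and> last p = d \<and> successively (\<lambda>x y. b < A x y) (r # p)"
      using level_component_path[OF _ E2_def, of y u d r] u \<open>d \<in> D2\<close> sym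
      by (simp add: D2_def X2_def)
  qed
  moreover have "full_component A b U R D1"
    unfolding full_component_def
  proof (intro conjI ballI impI)
    show "D1 \<subseteq> U" "D1 \<inter> R = {}" using D1 by (auto simp: X1_def)
    show "v \<in> D1 \<union> R" if "u \<in> D1" "v \<in> U" "b < A u v" for u v
    proof (cases "v \<in> R")
      case False
      with that D1 have "(u, v) \<in> E1" by (auto simp: E1_def X1_def)
      with that show ?thesis by (auto simp: D1_def)
    qed simp
    fix r d assume "r \<in> R" "d \<in> D1"
    then have "b < A r x" using R[of r] sym x by (auto simp: R_def)
    then show "\<exists>p. p \<noteq> [] \<and> set p \<subseteq> D1 \<and> last p = d \<and> successively (\<lambda>x y. b < A x y) (r # p)"
      using level_component_path[OF _ E1_def, of x x d r] \<open>d \<in> D1\<close> sym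
      by (simp add: D1_def X1_def)
  qed
  moreover have "R \<subseteq> U" by (auto simp: R_def)
  moreover have "D1 \<inter> D2 = {}" using D1 by auto
  moreover have "x \<in> D1" "y \<in> D2" by (auto simp: D1_def D2_def)
  ultimately show ?thesis using that by blast
qed

section \<open>Prolonging walks through a component\<close>

text \<open>An end in \<open>Z\<close> is kept; otherwise a shortest path from
  \<open>t \<in> R\<close> through \<open>D2\<close> to \<open>T\<close> is appended. The one new
  triple has its outer vertices in \<open>D1\<close> and \<open>D2\<close>, between which no entry
  exceeds \<open>b\<close>.\<close>

lemma prolong_end:
  fixes A :: "'a \<Rightarrow> 'a \<Rightarrow> real"
  assumes sym: "\<forall>x\<in>U. \<forall>y\<in>U. A x y = A y x" and low: "\<forall>x\<in>U. \<forall>y\<in>U. b \<le> A x y"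
    and comp: "full_component A b U R D1" "full_component A b U R D2" "D1 \<inter> D2 = {}" "R \<subseteq> U"
    and wc: "weighted_chordless A (s # ws @ [t])" and ws: "ws \<noteq> []" "set ws \<subseteq> U" "last ws \<in> D1"
    and s: "s \<in> U" and t: "t \<in> Z \<or> t \<in> R" and T: "T \<inter> D2 \<noteq> {}"
  obtains vs t' where "t' \<in> Z \<or> t' \<in> T \<inter> D2" "set vs \<subseteq> (R - Z) \<union> (D2 - T)"
    "weighted_chordless A (s # (ws @ vs) @ [t'])"
proof (cases "t \<in> Z")
  case True
  then show ?thesis using that[of t "[]"] wc by simp
next
  case False
  with t have tR: "t \<in> R" by simp
  obtain d where d: "d \<in> T" "d \<in> D2" using T by blast
  with comp(2) tR have "\<exists>p. p \<noteq> [] \<and> set p \<subseteq> D2 \<and> last p = d \<and> successively (\<lambda>x y. b < A x y) (t # p)"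
    unfolding full_component_def by simp
  with d(1) obtain p0 where p0: "p0 \<noteq> []" "set p0 \<subseteq> D2" "last p0 \<in> T"
    "successively (\<lambda>x y. b < A x y) (t # p0)"
    by auto
  have D: "D1 \<subseteq> U" "D2 \<subseteq> U" "D2 \<inter> R = {}" using comp(1,2) by (simp_all add: full_component_def)
  obtain p t' where p: "t' \<in> T" "t' \<in> D2" "set p \<subseteq> D2 - T" "b < A t (hd (p @ [t']))"
    "weighted_chordless A (t # p @ [t'])"
    by (rule shortest_level_path[OF sym D(2) p0])
  obtain us l where l: "ws = us @ [l]" using ws(1) by (metis append_butlast_last_id)
  \<comment> \<open>\<open>k\<close> precedes the last inner vertex \<open>l\<close>, with
    \<open>k = s\<close> if \<open>ws = [l]\<close>. Chordlessness at \<open>l\<close> and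
    minimality of \<open>b\<close> make \<open>l\<close>, \<open>t\<close> an edge above
    \<open>b\<close>.\<close>
  obtain us' k where k: "s # us = us' @ [k]" by (metis append_butlast_last_id list.distinct(1))
  have "s # ws @ [t] = (s # us) @ [l, t]" by (simp add: l)
  also have "\<dots> = us' @ k # l # t # []" unfolding k by simp
  finally have "A k t < A t l"
    using wc[unfolded weighted_chordless_iff, rule_format, of us' k l t "[]"] by simp
  moreover have "k \<in> U"
  proof -
    have "k \<in> set (s # us)" unfolding k by simp
    then show ?thesis using s ws(2) l by auto
  qed
  moreover have tU: "t \<in> U" using tR comp(4) by blast
  ultimately have tl: "b < A t l" using low by (meson le_less_trans)
  obtain z zs where z: "p @ [t'] = z # zs" by (cases "p @ [t']") auto
  have "z \<in> D2" using z p(2,3) by (cases p) auto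
  have "l \<in> D1" using ws(3) l by simp
  have lz: "l \<in> U" "z \<in> U" using \<open>l \<in> D1\<close> \<open>z \<in> D2\<close> D by blast+
  have "z \<notin> D1 \<union> R" using \<open>z \<in> D2\<close> D(3) comp(3) by blast
  with comp(1) \<open>l \<in> D1\<close> lz(2) have "\<not> b < A l z" unfolding full_component_def by blast
  moreover have "b < A l t" "b < A z t"
    using sym tl p(4) z lz tU by auto
  ultimately have "A l z < min (A l t) (A z t)" by simp
  then have "weighted_chordless A ((s # us) @ l # t # z # zs)"
    using weighted_chordless_append[of A "s # us" l t z zs] wc p(5) z l by simp
  then have "weighted_chordless A (s # (ws @ t # p) @ [t'])" using l z by simp
  then show ?thesis using that[of t' "t # p"] p tR False by auto
qed

lemma prolong_both_ends:
  fixes A :: "'a \<Rightarrow> 'a \<Rightarrow> real"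
  assumes sym: "\<forall>x\<in>U. \<forall>y\<in>U. A x y = A y x" and low: "\<forall>x\<in>U. \<forall>y\<in>U. b \<le> A x y"
    and comp: "full_component A b U R D1" "full_component A b U R D2" "D1 \<inter> D2 = {}" "R \<subseteq> U"
    and wc: "weighted_chordless A (s # ws @ [t])" and ws: "ws \<noteq> []" "set ws \<subseteq> D1"
    and Z: "Z \<subseteq> U" and s: "s \<in> Z \<or> s \<in> R" and t: "t \<in> Z \<or> t \<in> R" and T: "T \<inter> D2 \<noteq> {}"
  obtains ws' s' t' where "s' \<in> Z \<or> s' \<in> T \<inter> D2" "t' \<in> Z \<or> t' \<in> T \<inter> D2"
    "set ws \<subseteq> set ws'" "set ws' \<subseteq> set ws \<union> (R - Z) \<union> (D2 - T)"
    "weighted_chordless A (s' # ws' @ [t'])"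
proof -
  have D: "D1 \<subseteq> U" "D2 \<subseteq> U" using comp by (auto simp: full_component_def)
  have sU: "s \<in> U" using s Z comp(4) by auto
  obtain vs t' where 1: "t' \<in> Z \<or> t' \<in> T \<inter> D2" "set vs \<subseteq> (R - Z) \<union> (D2 - T)"
    "weighted_chordless A (s # (ws @ vs) @ [t'])"
    using prolong_end[OF sym low comp wc ws(1) _ _ sU t T] ws D by (metis in_mono last_in_set subset_trans)
  have t'U: "t' \<in> U" and vsU: "set vs \<subseteq> U" using 1 Z D comp(4) by auto
  \<comment> \<open>Reversal turns the other end into the last one; the reversed interior now ends
    with the first vertex of \<open>ws\<close>, which is in \<open>D1\<close>.\<close>
  have "weighted_chordless A (rev (s # (ws @ vs) @ [t']))"
    by (rule weighted_chordless_rev[OF sym _ 1(3)]) (use sU t'U vsU ws D in auto)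
  then have wc': "weighted_chordless A (t' # rev (ws @ vs) @ [s])" by simp
  obtain vs' s' where 2: "s' \<in> Z \<or> s' \<in> T \<inter> D2" "set vs' \<subseteq> (R - Z) \<union> (D2 - T)"
    "weighted_chordless A (t' # (rev (ws @ vs) @ vs') @ [s'])"
    by (rule prolong_end[OF sym low comp wc' _ _ _ t'U s T])
       (use ws vsU D in \<open>auto simp: last_rev hd_append\<close>)
  show ?thesis
    by (rule that[OF 1(1) 2(1) _ _ 2(3)]) (use 1(2) 2(2) in auto)
qed

section \<open>Walks through sets without simplicial vertices\<close>

lemma self_contained_pair_mono:
  "self_contained_pair U A W1 W2 \<Longrightarrow> U \<subseteq> V \<Longrightarrow> self_contained_pair V A W1 W2"
  by (auto simp: self_contained_pair_def walk_def)

text \<open>Walks may return to \<open>v\<^sub>i\<^sub>-\<^sub>1 = v\<^sub>i\<^sub>+\<^sub>1\<close> and then compare with a diagonal entry, which simpliciality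
  ignores; a dominant diagonal rules this out.\<close>

lemma chordless_walk_through:
  fixes A :: "'a \<Rightarrow> 'a \<Rightarrow> real"
  assumes "finite U" "C \<subseteq> U" "C \<noteq> {}"
    and "\<forall>x\<in>U. \<forall>y\<in>U. A x y = A y x" and "\<forall>x\<in>U. \<forall>y\<in>U. A x y \<le> A x x"
    and "\<not> (\<exists>W1 W2. self_contained_pair U A W1 W2)"
    and "\<forall>c\<in>C. \<not> simplicial U A c"
  shows "\<exists>s ws t. s \<in> U - C \<and> t \<in> U - C \<and> ws \<noteq> [] \<and> set ws \<subseteq> C \<and> weighted_chordless A (s # ws @ [t])"
  using assms
proof (induction U arbitrary: C rule: finite_psubset_induct)
  case (psubset U)
  note C = psubset.prems(1,2) and sym = psubset.prems(3) and diag = psubset.prems(4)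
    and no_pair = psubset.prems(5) and nonsimp = psubset.prems(6)
  define M where "M = (\<lambda>(x, y). A x y) ` (U \<times> U)"
  define b where "b = Min M"
  have M: "finite M" "M \<noteq> {}" using psubset.hyps(1) C by (auto simp: M_def)
  have low: "\<forall>x\<in>U. \<forall>y\<in>U. b \<le> A x y" unfolding b_def by (intro ballI Min_le M(1)) (force simp: M_def)
  obtain x0 y0 where xy0: "x0 \<in> U" "y0 \<in> U" "A x0 y0 = b"
    using Min_in[OF M] by (auto simp: b_def M_def)
  have bad: "\<exists>y\<in>U-{c}. \<exists>z\<in>U-{c}. y \<noteq> z \<and> A y z < A c y \<and> A y z < A c z" if "c \<in> C" for c
    using nonsimp that C(1) by (fastforce simp: simplicial_def not_le)
  \<comment> \<open>Here the dominant diagonal enters: it gives the loop that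
    \<open>level_separator\<close> demands.\<close>
  have loop: "b < A c c" if c: "c \<in> C" for c
  proof -
    obtain y z where "y \<in> U" "z \<in> U" "A y z < A c y" using bad[OF c] by blast
    then show ?thesis using low diag c C(1) by fastforce
  qed
  \<comment> \<open>The witnesses against \<open>c\<close> being simplicial are joined to
    \<open>c\<close> by entries above \<open>b\<close>, hence lie in \<open>D \<union> R\<close>. So
    \<open>c\<close> stays non-simplicial there, and the induction hypothesis applies;
    \<open>y\<close> makes the subset proper.\<close>
  have side: "\<exists>s ws t. s \<in> R \<union> (D - C) \<and> t \<in> R \<union> (D - C) \<and> ws \<noteq> [] \<and> set ws \<subseteq> D \<inter> C \<and>
      weighted_chordless A (s # ws @ [t])"
    if comp: "full_component A b U R D" and R: "R \<subseteq> U" and DC: "D \<inter> C \<noteq> {}" and y: "y \<in> U" "y \<notin> D \<union> R"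
    for R D y
  proof -
    let ?U = "D \<union> R"
    have D: "D \<subseteq> U" "D \<inter> R = {}" and closed: "\<And>x y. x \<in> D \<Longrightarrow> y \<in> U \<Longrightarrow> b < A x y \<Longrightarrow> y \<in> ?U"
      using comp by (auto simp: full_component_def)
    have "\<exists>s ws t. s \<in> ?U - D \<inter> C \<and> t \<in> ?U - D \<inter> C \<and> ws \<noteq> [] \<and> set ws \<subseteq> D \<inter> C \<and>
        weighted_chordless A (s # ws @ [t])"
    proof (rule psubset.IH)
      show "?U \<subset> U" using D R y by auto
      show "D \<inter> C \<noteq> {}" by (rule DC)
      show "\<forall>x\<in>?U. \<forall>y\<in>?U. A x y = A y x" using sym D R by blast
      show "\<forall>x\<in>?U. \<forall>y\<in>?U. A x y \<le> A x x" using diag D R by blast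
      show "\<nexists>W1 W2. self_contained_pair ?U A W1 W2"
        using no_pair self_contained_pair_mono[of ?U A _ _ U] D R by blast
      show "\<forall>c\<in>D \<inter> C. \<not> simplicial ?U A c"
      proof
        fix c assume c: "c \<in> D \<inter> C"
        then obtain y z where yz: "y \<in> U - {c}" "z \<in> U - {c}" "y \<noteq> z" "A y z < A c y" "A y z < A c z"
          using bad by blast
        then have "b < A c y" "b < A c z" using low by fastforce+
        then have "y \<in> ?U" "z \<in> ?U" using closed c yz by blast+
        then show "\<not> simplicial ?U A c" using yz unfolding simplicial_def by fastforce
      qed
    qed auto
    then show ?thesis using D by blast
  qed
  \<comment> \<open>Ends in \<open>R \<inter> C\<close> are prolonged through \<open>D2\<close> up
    to its first vertex outside \<open>C\<close>, so all added inner vertices remain in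
    \<open>C\<close>.\<close>
  have escape: ?case
    if comp: "full_component A b U R D1" "full_component A b U R D2" "D1 \<inter> D2 = {}" "R \<subseteq> U"
      and D1C: "D1 \<inter> C \<noteq> {}" and D2C: "D2 - C \<noteq> {}" for R D1 D2
  proof -
    have D: "D1 \<subseteq> U" "D2 \<subseteq> U" "D2 \<inter> R = {}" using comp by (auto simp: full_component_def)
    obtain y where "y \<in> D2" using D2C by blast
    then have "y \<in> U" "y \<notin> D1 \<union> R" using D comp(3) by blast+
    from side[OF comp(1,4) D1C this] obtain s ws t where w: "s \<in> R \<union> (D1 - C)" "t \<in> R \<union> (D1 - C)" "ws \<noteq> []"
      "set ws \<subseteq> D1 \<inter> C" "weighted_chordless A (s # ws @ [t])"
      by (elim exE conjE)
    obtain ws' s' t' where w': "s' \<in> U - C \<or> s' \<in> (U - C) \<inter> D2" "t' \<in> U - C \<or> t' \<in> (U - C) \<inter> D2"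
      "set ws \<subseteq> set ws'" "set ws' \<subseteq> set ws \<union> (R - (U - C)) \<union> (D2 - (U - C))"
      "weighted_chordless A (s' # ws' @ [t'])"
      by (rule prolong_both_ends[OF sym low comp w(5,3), where Z = "U - C" and T = "U - C"])
         (use w(1,2,4) D D2C comp(4) in auto)
    have "ws' \<noteq> []" using w'(3) w(3) by auto
    moreover have "set ws' \<subseteq> C" using w'(4) w(4) D comp(4) by blast
    moreover have "s' \<in> U - C" "t' \<in> U - C" using w'(1,2) by auto
    ultimately show ?thesis using w'(5) by (intro exI conjI)
  qed
  show ?case
  proof (cases "\<exists>c\<in>C. \<exists>y\<in>U. A c y \<le> b")
    \<comment> \<open>A pair attaining the least entry \<open>b\<close> must avoid \<open>C\<close>,
      so any \<open>c \<in> C\<close> between its two members gives the walk.\<close>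
    case False
    then have above: "b < A c y" if "c \<in> C" "y \<in> U" for c y using that by (simp add: not_le)
    have "A y0 x0 = b" using xy0 sym by metis
    then have "x0 \<in> U - C" "y0 \<in> U - C" using above[of x0 y0] above[of y0 x0] xy0 by auto
    moreover obtain c where c: "c \<in> C" using C(2) by blast
    moreover have "b < A x0 c" "b < A y0 c"
      using above[OF c xy0(1)] above[OF c xy0(2)] sym c C(1) xy0 by auto
    ultimately show ?thesis using xy0
      by (intro exI[of _ x0] exI[of _ "[c]"] exI[of _ y0])
         (simp add: weighted_chordless_iff Cons_eq_append_conv append_eq_Cons_conv)
  next
    case True
    then obtain c y where c: "c \<in> C" and y: "y \<in> U" "A c y \<le> b" by blast
    obtain R D1 D2 where comp: "R \<subseteq> U" "full_component A b U R D1" "full_component A b U R D2"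
      "D1 \<inter> D2 = {}" "c \<in> D1" "y \<in> D2"
      by (rule level_separator[OF sym _ loop[OF c] y]) (use c C(1) in auto)
    have comp': "D2 \<inter> D1 = {}" using comp(4) by blast
    have D: "D1 \<subseteq> U" "D2 \<subseteq> U" "D1 \<inter> R = {}" "D2 \<inter> R = {}"
      using comp(2,3) by (auto simp: full_component_def)
    consider "D2 - C \<noteq> {}" | "D1 - C \<noteq> {}" "D2 \<inter> C \<noteq> {}" | "D1 \<subseteq> C" "D2 \<subseteq> C"
      using comp(6) by blast
    then show ?thesis
    proof cases
      case 1
      then show ?thesis using escape[OF comp(2-4,1)] c comp(5) by blast
    next
      case 2
      then show ?thesis using escape[OF comp(3,2) comp' comp(1)] by blast
    next
      case 3
      have "D1 \<inter> C \<noteq> {}" "y \<notin> D1 \<union> R" using c comp D by blast+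
      from side[OF comp(2,1) this(1) y(1) this(2)] obtain s1 ws1 t1 where w1: "s1 \<in> R" "t1 \<in> R" "ws1 \<noteq> []" "set ws1 \<subseteq> D1"
        "weighted_chordless A (s1 # ws1 @ [t1])"
        using 3 by (elim exE conjE) auto
      have "D2 \<inter> C \<noteq> {}" "c \<in> U" "c \<notin> D2 \<union> R" using 3 comp D by blast+
      from side[OF comp(3,1) this] obtain s2 ws2 t2 where w2: "s2 \<in> R" "t2 \<in> R" "ws2 \<noteq> []" "set ws2 \<subseteq> D2"
        "weighted_chordless A (s2 # ws2 @ [t2])"
        using 3 by (elim exE conjE) auto
      \<comment> \<open>With \<open>Z\<close> empty both ends of each walk are prolonged, up to the
        interior of the other walk. Since each old interior is kept, all four new ends are inner
        vertices of the other new walk.\<close>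
      have T: "set ws2 \<inter> D2 \<noteq> {}" "set ws1 \<inter> D1 \<noteq> {}" using w1 w2 by (auto simp: Int_absorb2)
      obtain vs1 p1 q1 where v1: "p1 \<in> {} \<or> p1 \<in> set ws2 \<inter> D2" "q1 \<in> {} \<or> q1 \<in> set ws2 \<inter> D2"
        "set ws1 \<subseteq> set vs1" "set vs1 \<subseteq> set ws1 \<union> (R - {}) \<union> (D2 - set ws2)"
        "weighted_chordless A (p1 # vs1 @ [q1])"
        by (rule prolong_both_ends[OF sym low comp(2-4,1) w1(5,3,4) _ _ _ T(1), where Z = "{}"])
           (use w1(1,2) in auto)
      obtain vs2 p2 q2 where v2: "p2 \<in> {} \<or> p2 \<in> set ws1 \<inter> D1" "q2 \<in> {} \<or> q2 \<in> set ws1 \<inter> D1"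
        "set ws2 \<subseteq> set vs2" "set vs2 \<subseteq> set ws2 \<union> (R - {}) \<union> (D1 - set ws1)"
        "weighted_chordless A (p2 # vs2 @ [q2])"
        by (rule prolong_both_ends[OF sym low comp(3,2) comp' comp(1) w2(5,3,4) _ _ _ T(2), where Z = "{}"])
           (use w2(1,2) in auto)
      have "set vs1 \<subseteq> U" "set vs2 \<subseteq> U" using v1(4) v2(4) w1(4) w2(4) D(1,2) comp(1) by blast+
      have "self_contained_pair U A (p1 # vs1 @ [q1]) (p2 # vs2 @ [q2])"
        unfolding self_contained_pair_def walk_inner_eq
        using v1(1-3,5) v2(1-3,5) \<open>set vs1 \<subseteq> U\<close> \<open>set vs2 \<subseteq> U\<close> w1(4) w2(4) D(1,2) by (auto simp: walk_def walk_verts_def)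
      with no_pair show ?thesis by blast
    qed
  qed
qed

theorem theorem3:
  fixes V :: "'a set" and A :: "'a \<Rightarrow> 'a \<Rightarrow> real"
  assumes "finite V" and "V \<noteq> {}"
    and "\<forall>x\<in>V. \<forall>y\<in>V. A x y = A y x"
    and "\<not> (\<exists>W1 W2. self_contained_pair V A W1 W2)"
  shows "\<exists>v. simplicial V A v"
proof (rule ccontr)
  assume no_simp: "\<not> (\<exists>v. simplicial V A v)"
  \<comment> \<open>Raising the diagonal to the maximal entry makes it dominant and leaves
    simpliciality unchanged, as that compares off-diagonal entries only.\<close>
  define m where "m = Max ((\<lambda>(x, y). A x y) ` (V \<times> V))"
  have m: "A x y \<le> m" if "x \<in> V" "y \<in> V" for x y
    unfolding m_def using assms(1) that by (intro Max_ge) auto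
  define B where "B = (\<lambda>x y. if x = y then m else A x y)"
  \<comment> \<open>A triple chordless in \<open>B\<close> has distinct members:
    \<open>x = z\<close> would need an entry above \<open>m\<close>, and \<open>y = x\<close> or
    \<open>y = z\<close> an entry below itself. On such triples \<open>B\<close> agrees with
    \<open>A\<close>.\<close>
  have wc: "weighted_chordless A W" if "weighted_chordless B W" "set W \<subseteq> V" for W
    unfolding weighted_chordless_iff
  proof (intro allI impI)
    fix us x y z vs assume W: "W = us @ x # y # z # vs"
    then have "B x z < min (B x y) (B z y)" using that(1) unfolding weighted_chordless_iff by blast
    moreover have "x \<in> V" "y \<in> V" "z \<in> V" using that(2) W by auto
    ultimately show "A x z < min (A x y) (A z y)"
      using m assms(3) by (fastforce simp: B_def split: if_splits)
  qed
  have "\<exists>s ws t. s \<in> V - V \<and> t \<in> V - V \<and> ws \<noteq> [] \<and> set ws \<subseteq> V \<and> weighted_chordless B (s # ws @ [t])"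
  proof (rule chordless_walk_through)
    show "\<forall>x\<in>V. \<forall>y\<in>V. B x y = B y x" using assms(3) by (simp add: B_def)
    show "\<forall>x\<in>V. \<forall>y\<in>V. B x y \<le> B x x" using m by (simp add: B_def)
    show "\<nexists>W1 W2. self_contained_pair V B W1 W2"
      using assms(4) wc unfolding self_contained_pair_def walk_def by blast
    have "simplicial V B c \<longleftrightarrow> simplicial V A c" for c
      unfolding simplicial_def B_def by (intro conj_cong refl ball_cong imp_cong) auto
    then show "\<forall>c\<in>V. \<not> simplicial V B c" using no_simp by simp
  qed (use assms in auto)
  then show False by blast
qed

end
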